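(* Let $q\in\mathbb{C}$ be nonzero and not a root of unity, and let $(\mathcal{W}_q,[\cdot,\cdot]_q,\alpha)$ be the $q$-deformed $W(2,2)$ algebra regarded as a Hom-Lie algebra. For every integer $k>0$, all the $\alpha^k$-derivations of $\mathcal{W}_q$ are zero.
   Context: All vector spaces and algebras are over $\mathbb{C}$. The $q$-number is $[n]_q=\frac{q^n-q^{-n}}{q-q^{-1}}$. The $q$-deformed $W(2,2)$ algebra $\mathcal{W}_q$ is the vector space with basis $\{L_n,M_n: n\in\mathbb{Z}\}$ and skew-symmetric bilinear bracket $[L_n,L_m]_q=[m-n]_qL_{m+n}$, $[L_n,M_m]_q=[m-n]_qM_{m+n}$, $[M_n,M_m]_q=0$. With the linear map $\alpha(L_n)=(q^n+q^{-n})L_n$, $\alpha(M_n)=(q^n+q^{-n})M_n$ it is a Hom-Lie algebra. For a nonnegative integer $k$, $\alpha^k$ is the $k$-fold composition of $\alpha$ ($\alpha^0=\mathrm{id}$). An $\alpha^k$-derivation of $\mathcal{W}_q$ is a linear map $D:\mathcal{W}_q\to\mathcal{W}_q$ with $D\circ\alpha=\alpha\circ D$ and $D([x,y]_q)=[\alpha^k(x),D(y)]_q-[\alpha^k(y),D(x)]_q$ for all $x,y\in\mathcal{W}_q$. *)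

theory Defs
  imports Complex_Main "HOL-Library.Poly_Mapping"
begin

section \<open>Hom-Lie algebras and their $\alpha^k$-derivations\<close>

definition skew_bilinear ::
    "(complex \<Rightarrow> 'v::ab_group_add \<Rightarrow> 'v) \<Rightarrow> ('v \<Rightarrow> 'v \<Rightarrow> 'v) \<Rightarrow> bool" where
  "skew_bilinear scale br \<longleftrightarrow>
     (\<forall>x. Vector_Spaces.linear scale scale (\<lambda>y. br x y)) \<and>
     (\<forall>y. Vector_Spaces.linear scale scale (\<lambda>x. br x y)) \<and>
     (\<forall>x y. br x y = - br y x)"

definition hom_Lie_algebra ::
    "(complex \<Rightarrow> 'v::ab_group_add \<Rightarrow> 'v) \<Rightarrow> ('v \<Rightarrow> 'v \<Rightarrow> 'v) \<Rightarrow> ('v \<Rightarrow> 'v) \<Rightarrow> bool" where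
  "hom_Lie_algebra scale br \<alpha> \<longleftrightarrow>
     skew_bilinear scale br \<and> Vector_Spaces.linear scale scale \<alpha> \<and>
     (\<forall>x y z. br (\<alpha> x) (br y z) + br (\<alpha> y) (br z x) + br (\<alpha> z) (br x y) = 0)"

definition alpha_derivation ::
    "(complex \<Rightarrow> 'v::ab_group_add \<Rightarrow> 'v) \<Rightarrow> ('v \<Rightarrow> 'v \<Rightarrow> 'v) \<Rightarrow> ('v \<Rightarrow> 'v)
      \<Rightarrow> nat \<Rightarrow> ('v \<Rightarrow> 'v) \<Rightarrow> bool" where
  "alpha_derivation scale br \<alpha> k D \<longleftrightarrow>
     Vector_Spaces.linear scale scale D \<and>
     D \<circ> \<alpha> = \<alpha> \<circ> D \<and>
     (\<forall>x y. D (br x y) = br ((\<alpha> ^^ k) x) (D y) - br ((\<alpha> ^^ k) y) (D x))"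


section \<open>The $q$-deformed $W(2,2)$ algebra\<close>

definition qnum :: "complex \<Rightarrow> int \<Rightarrow> complex" where
  "qnum q n = (q powi n - q powi (- n)) / (q - inverse q)"

datatype W_index = L_index int | M_index int

text \<open>
  The underlying space is the free complex vector space on the index set; it does not depend
  on \<open>q\<close>, which only enters through the bracket and the twist \<open>\<alpha>\<close>.
\<close>
type_synonym W = "W_index \<Rightarrow>\<^sub>0 complex"

definition scaleW :: "complex \<Rightarrow> W \<Rightarrow> W" where
  "scaleW c x = Poly_Mapping.map ((*) c) x"

definition L :: "int \<Rightarrow> W" where "L n = Poly_Mapping.single (L_index n) 1"

definition M :: "int \<Rightarrow> W" where "M n = Poly_Mapping.single (M_index n) 1"

fun bracket_basis :: "complex \<Rightarrow> W_index \<Rightarrow> W_index \<Rightarrow> W" where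
  "bracket_basis q (L_index n) (L_index m) = scaleW (qnum q (m - n)) (L (m + n))"
| "bracket_basis q (L_index n) (M_index m) = scaleW (qnum q (m - n)) (M (m + n))"
| "bracket_basis q (M_index n) (L_index m) = - scaleW (qnum q (n - m)) (M (n + m))"
| "bracket_basis q (M_index n) (M_index m) = 0"

definition bracketW :: "complex \<Rightarrow> W \<Rightarrow> W \<Rightarrow> W" where
  "bracketW q x y =
     (\<Sum>i\<in>Poly_Mapping.keys x. \<Sum>j\<in>Poly_Mapping.keys y.
        scaleW (Poly_Mapping.lookup x i * Poly_Mapping.lookup y j) (bracket_basis q i j))"

fun alpha_basis :: "complex \<Rightarrow> W_index \<Rightarrow> W" where
  "alpha_basis q (L_index n) = scaleW (q powi n + q powi (- n)) (L n)"
| "alpha_basis q (M_index n) = scaleW (q powi n + q powi (- n)) (M n)"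

definition alphaW :: "complex \<Rightarrow> W \<Rightarrow> W" where
  "alphaW q x = (\<Sum>i\<in>Poly_Mapping.keys x. scaleW (Poly_Mapping.lookup x i) (alpha_basis q i))"


section \<open>The defining properties hold\<close>

lemma lookup_scaleW [simp]: "Poly_Mapping.lookup (scaleW c x) i = c * Poly_Mapping.lookup x i"
  unfolding scaleW_def by (simp add: Poly_Mapping.map.rep_eq when_def)

lemma vector_space_scaleW: "vector_space scaleW"
  by unfold_locales (auto intro!: poly_mapping_eqI simp: lookup_add algebra_simps)

interpretation W: vector_space scaleW
  by (rule vector_space_scaleW)

lemma linearW_iff:
  "Vector_Spaces.linear scaleW scaleW f \<longleftrightarrow>
     (\<forall>x y. f (x + y) = f x + f y) \<and> (\<forall>c x. f (scaleW c x) = scaleW c (f x))"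
  by (simp add: Vector_Spaces.linear_iff vector_space_scaleW)

lemma sum_keys_superset:
  fixes g :: "W_index \<Rightarrow> W"
  assumes "finite A" "Poly_Mapping.keys x \<subseteq> A"
  shows "(\<Sum>i\<in>Poly_Mapping.keys x. scaleW (Poly_Mapping.lookup x i) (g i))
       = (\<Sum>i\<in>A. scaleW (Poly_Mapping.lookup x i) (g i))"
  using assms by (intro sum.mono_neutral_left) (auto simp: in_keys_iff)

lemma linear_extension:
  fixes g :: "W_index \<Rightarrow> W"
  shows "Vector_Spaces.linear scaleW scaleW
     (\<lambda>x. \<Sum>i\<in>Poly_Mapping.keys x. scaleW (Poly_Mapping.lookup x i) (g i))"
    (is "Vector_Spaces.linear _ _ ?f")
  unfolding linearW_iff
proof (intro conjI allI)
  fix x y :: W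
  let ?A = "Poly_Mapping.keys x \<union> Poly_Mapping.keys y"
  have "?f (x + y) = (\<Sum>i\<in>?A. scaleW (Poly_Mapping.lookup (x + y) i) (g i))"
    by (rule sum_keys_superset) (auto dest: Poly_Mapping.keys_add[THEN subsetD])
  moreover have "?f x = (\<Sum>i\<in>?A. scaleW (Poly_Mapping.lookup x i) (g i))"
    by (rule sum_keys_superset) auto
  moreover have "?f y = (\<Sum>i\<in>?A. scaleW (Poly_Mapping.lookup y i) (g i))"
    by (rule sum_keys_superset) auto
  ultimately show "?f (x + y) = ?f x + ?f y"
    by (simp add: lookup_add W.scale_left_distrib sum.distrib)
next
  fix c :: complex and x :: W
  have "?f (scaleW c x) = (\<Sum>i\<in>Poly_Mapping.keys x. scaleW (Poly_Mapping.lookup (scaleW c x) i) (g i))"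
    by (rule sum_keys_superset) (auto simp: in_keys_iff)
  then show "?f (scaleW c x) = scaleW c (?f x)"
    by (simp add: W.scale_sum_right)
qed

lemma linear_alphaW: "Vector_Spaces.linear scaleW scaleW (alphaW q)"
  using linear_extension[of "alpha_basis q"] by (simp add: alphaW_def[abs_def])

lemma bracketW_alt:
  "bracketW q x y = (\<Sum>i\<in>Poly_Mapping.keys x. scaleW (Poly_Mapping.lookup x i)
      (\<Sum>j\<in>Poly_Mapping.keys y. scaleW (Poly_Mapping.lookup y j) (bracket_basis q i j)))"
  by (simp add: bracketW_def W.scale_sum_right)

lemma bracketW_alt':
  "bracketW q x y = (\<Sum>j\<in>Poly_Mapping.keys y. scaleW (Poly_Mapping.lookup y j)
      (\<Sum>i\<in>Poly_Mapping.keys x. scaleW (Poly_Mapping.lookup x i) (bracket_basis q i j)))"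
  unfolding bracketW_def by (subst sum.swap) (simp add: W.scale_sum_right mult.commute)

lemma linear_bracketW_left: "Vector_Spaces.linear scaleW scaleW (\<lambda>x. bracketW q x y)"
  unfolding bracketW_alt by (rule linear_extension)

lemma linear_bracketW_right: "Vector_Spaces.linear scaleW scaleW (\<lambda>y. bracketW q x y)"
  unfolding bracketW_alt' by (rule linear_extension)

lemma W_basis_expansion:
  "x = (\<Sum>i\<in>Poly_Mapping.keys x. scaleW (Poly_Mapping.lookup x i) (Poly_Mapping.single i 1))"
  by (rule poly_mapping_eqI)
     (simp add: lookup_sum lookup_single when_def in_keys_iff if_distrib cong: if_cong)

lemma bracketW_simps:
  "bracketW q (L n) (L m) = scaleW (qnum q (m - n)) (L (m + n))"
  "bracketW q (L n) (M m) = scaleW (qnum q (m - n)) (M (m + n))"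
  "bracketW q (M n) (L m) = - scaleW (qnum q (n - m)) (M (n + m))"
  "bracketW q (M n) (M m) = 0"
  by (simp_all add: bracketW_def L_def M_def)

lemma alphaW_simps:
  "alphaW q (L n) = scaleW (q powi n + q powi (- n)) (L n)"
  "alphaW q (M n) = scaleW (q powi n + q powi (- n)) (M n)"
  by (simp_all add: alphaW_def L_def M_def)

lemma W_induct [case_names L M add scale]:
  assumes "\<And>n. P (L n)" "\<And>n. P (M n)"
    and add: "\<And>x y. P x \<Longrightarrow> P y \<Longrightarrow> P (x + y)"
    and scale: "\<And>c x. P x \<Longrightarrow> P (scaleW c x)"
  shows "P x"
proof -
  have single: "P (Poly_Mapping.single i 1)" for i
    using assms(1,2) by (cases i) (auto simp: L_def M_def)
  have zero: "P 0"
    using scale[OF assms(1), of 0] by simp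
  have "P (\<Sum>i\<in>A. scaleW (f i) (Poly_Mapping.single i 1))" if "finite A" for A f
    using that by (induction A) (auto intro: zero add scale single)
  then show ?thesis
    by (subst W_basis_expansion) simp
qed

lemmas bracketW_bilinear =
  linear_bracketW_left[unfolded linearW_iff, THEN conjunct1, rule_format]
  linear_bracketW_left[unfolded linearW_iff, THEN conjunct2, rule_format]
  linear_bracketW_right[unfolded linearW_iff, THEN conjunct1, rule_format]
  linear_bracketW_right[unfolded linearW_iff, THEN conjunct2, rule_format]

lemmas alphaW_linear =
  linear_alphaW[unfolded linearW_iff, THEN conjunct1, rule_format]
  linear_alphaW[unfolded linearW_iff, THEN conjunct2, rule_format]

lemma qnum_minus: "qnum q (- n) = - qnum q n"
  by (simp add: qnum_def minus_divide_left)

lemma bracket_basis_skew: "bracket_basis q i j = - bracket_basis q j i"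
proof -
  have "scaleW (qnum q (m - n)) (L (m + n)) = - scaleW (qnum q (n - m)) (L (n + m))" for m n
  proof -
    have "scaleW (qnum q (- (n - m))) (L (m + n)) = - scaleW (qnum q (n - m)) (L (m + n))"
      by (simp only: qnum_minus W.scale_minus_left)
    then show ?thesis by (simp only: minus_diff_eq add.commute)
  qed
  note LL = this
  show ?thesis
  proof (cases i; cases j)
    fix n m assume "i = L_index n" "j = L_index m"
    then show ?thesis by (simp only: bracket_basis.simps LL[of m n])
  qed simp_all
qed

lemma bracketW_skew: "bracketW q x y = - bracketW q y x"
proof -
  have "bracketW q x y = (\<Sum>i\<in>Poly_Mapping.keys x. \<Sum>j\<in>Poly_Mapping.keys y.
      - scaleW (Poly_Mapping.lookup y j * Poly_Mapping.lookup x i) (bracket_basis q j i))"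
    unfolding bracketW_def
    by (intro sum.cong refl, subst bracket_basis_skew) (simp only: W.scale_minus_right mult.commute)
  also have "\<dots> = (\<Sum>j\<in>Poly_Mapping.keys y. \<Sum>i\<in>Poly_Mapping.keys x.
      - scaleW (Poly_Mapping.lookup y j * Poly_Mapping.lookup x i) (bracket_basis q j i))"
    by (rule sum.swap)
  also have "\<dots> = - bracketW q y x"
    by (simp only: bracketW_def sum_negf)
  finally show ?thesis .
qed

lemma jacobi_term:
  fixes x y z :: complex
  assumes "x \<noteq> 0" "y \<noteq> 0" "z \<noteq> 0"
  shows "(x + 1/x) * (z/y - y/z) * (z*y/x - x/(z*y))
    = z^2 - y^2 + (1/z^2 - 1/y^2) + (x^2/z^2 - x^2/y^2) + (z^2/x^2 - y^2/x^2)"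
proof -
  have "(z/y - y/z) * (z*y/x - x/(z*y)) = (z^2 - y^2)/x + x * (1/z^2 - 1/y^2)"
    using assms by (simp add: divide_simps) (simp add: algebra_simps power2_eq_square)
  moreover have "(x + 1/x) * (A/x + x * B) = A + B + x^2*B + A/x^2" for A B
    using assms by (simp add: field_simps power2_eq_square)
  ultimately show ?thesis by (simp only: mult.assoc) (simp add: right_diff_distrib diff_divide_distrib)
qed

lemma qnum_jacobi_term:
  assumes "q \<noteq> 0"
  shows "(q powi a + q powi (- a)) * qnum q (c - b) * qnum q (c + b - a)
    = ((q powi c)^2 - (q powi b)^2 + (1/(q powi c)^2 - 1/(q powi b)^2)
       + ((q powi a)^2/(q powi c)^2 - (q powi a)^2/(q powi b)^2)
       + ((q powi c)^2/(q powi a)^2 - (q powi b)^2/(q powi a)^2)) / (q - inverse q)^2"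
proof -
  define x y z where "x = q powi a" "y = q powi b" "z = q powi c"
  have nz: "x \<noteq> 0" "y \<noteq> 0" "z \<noteq> 0"
    using assms by (auto simp: x_y_z_def)
  have "(q powi a + q powi (- a)) * qnum q (c - b) * qnum q (c + b - a)
      = (x + 1/x) * (z/y - y/z) * (z*y/x - x/(z*y)) / (q - inverse q)^2"
    using assms unfolding x_y_z_def qnum_def minus_diff_eq
    by (simp add: power_int_diff power_int_add power_int_minus power2_eq_square inverse_eq_divide)
  then show ?thesis
    unfolding jacobi_term[OF nz] by (simp only: x_y_z_def)
qed

lemma qnum_jacobi:
  assumes "q \<noteq> 0"
  shows "(q powi a + q powi (- a)) * qnum q (c - b) * qnum q (c + b - a)
       + (q powi b + q powi (- b)) * qnum q (a - c) * qnum q (a + c - b)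
       + (q powi c + q powi (- c)) * qnum q (b - a) * qnum q (b + a - c) = 0"
  unfolding qnum_jacobi_term[OF assms] by (simp flip: add_divide_distrib)

lemma bracketW_ML: "bracketW q (M n) (L m) = scaleW (qnum q (m - n)) (M (m + n))"
  using qnum_minus[of q "m - n"] by (simp add: bracketW_simps add.commute)

lemma qnum_jacobi_scale:
  assumes "q \<noteq> 0"
  shows "scaleW ((q powi a + q powi (- a)) * (qnum q (c - b) * qnum q (c + b - a))) v
       + scaleW ((q powi b + q powi (- b)) * (qnum q (a - c) * qnum q (a + c - b))) v
       + scaleW ((q powi c + q powi (- c)) * (qnum q (b - a) * qnum q (b + a - c))) v = 0"
  unfolding W.scale_left_distrib[symmetric] mult.assoc[symmetric]
  unfolding qnum_jacobi[OF assms] by simp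

lemma bracketW_zero: "bracketW q 0 y = 0" "bracketW q x 0 = 0"
  by (simp_all add: bracketW_def)

lemma bracketW_nested:
  "bracketW q (alphaW q (L a)) (bracketW q (L b) (L c)) =
     scaleW ((q powi a + q powi (- a)) * (qnum q (c - b) * qnum q (c + b - a))) (L (a + b + c))"
  "bracketW q (alphaW q (L a)) (bracketW q (L b) (M c)) =
     scaleW ((q powi a + q powi (- a)) * (qnum q (c - b) * qnum q (c + b - a))) (M (a + b + c))"
  "bracketW q (alphaW q (L a)) (bracketW q (M b) (L c)) =
     scaleW ((q powi a + q powi (- a)) * (qnum q (c - b) * qnum q (c + b - a))) (M (a + b + c))"
  "bracketW q (alphaW q (M a)) (bracketW q (L b) (L c)) =
     scaleW ((q powi a + q powi (- a)) * (qnum q (c - b) * qnum q (c + b - a))) (M (a + b + c))"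
  "bracketW q (alphaW q (L a)) (bracketW q (M b) (M c)) = 0"
  "bracketW q (alphaW q (M a)) (bracketW q (L b) (M c)) = 0"
  "bracketW q (alphaW q (M a)) (bracketW q (M b) (L c)) = 0"
  "bracketW q (alphaW q (M a)) (bracketW q (M b) (M c)) = 0"
proof -
  have "c + b + a = a + b + c" by simp
  then show
    "bracketW q (alphaW q (L a)) (bracketW q (L b) (L c)) =
       scaleW ((q powi a + q powi (- a)) * (qnum q (c - b) * qnum q (c + b - a))) (L (a + b + c))"
    "bracketW q (alphaW q (L a)) (bracketW q (L b) (M c)) =
       scaleW ((q powi a + q powi (- a)) * (qnum q (c - b) * qnum q (c + b - a))) (M (a + b + c))"
    "bracketW q (alphaW q (L a)) (bracketW q (M b) (L c)) =
       scaleW ((q powi a + q powi (- a)) * (qnum q (c - b) * qnum q (c + b - a))) (M (a + b + c))"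
    "bracketW q (alphaW q (M a)) (bracketW q (L b) (L c)) =
       scaleW ((q powi a + q powi (- a)) * (qnum q (c - b) * qnum q (c + b - a))) (M (a + b + c))"
    by (simp_all only: bracketW_simps(1,2) bracketW_ML alphaW_simps bracketW_bilinear(2,4)
        W.scale_scale ac_simps(1-4))
       (simp_all add: ac_simps)
qed (simp_all add: bracketW_simps(1,2,4) bracketW_ML alphaW_simps bracketW_bilinear(2,4) bracketW_zero)

lemma bracketW_hom_jacobi:
  assumes "q \<noteq> 0"
  shows "bracketW q (alphaW q x) (bracketW q y z) + bracketW q (alphaW q y) (bracketW q z x)
       + bracketW q (alphaW q z) (bracketW q x y) = 0"
proof -
  define J where "J x y z = bracketW q (alphaW q x) (bracketW q y z)
    + bracketW q (alphaW q y) (bracketW q z x) + bracketW q (alphaW q z) (bracketW q x y)" for x y z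
  have add: "J (x + x') y z = J x y z + J x' y z" "J x (y + y') z = J x y z + J x y' z"
      "J x y (z + z') = J x y z + J x y z'" for x x' y y' z z'
    by (simp_all add: J_def bracketW_bilinear alphaW_linear)
  have scale: "J (scaleW c x) y z = scaleW c (J x y z)" "J x (scaleW c y) z = scaleW c (J x y z)"
      "J x y (scaleW c z) = scaleW c (J x y z)" for c x y z
    by (simp_all add: J_def bracketW_bilinear alphaW_linear W.scale_right_distrib mult.commute)
  have basis: "J (L a) (L b) (L c) = 0" "J (L a) (L b) (M c) = 0" "J (L a) (M b) (L c) = 0"
      "J (M a) (L b) (L c) = 0" "J (M a) (M b) (L c) = 0" "J (M a) (L b) (M c) = 0"
      "J (L a) (M b) (M c) = 0" "J (M a) (M b) (M c) = 0" for a b c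
    using qnum_jacobi_scale[OF assms, of a c b "L (a + b + c)"]
      qnum_jacobi_scale[OF assms, of a c b "M (a + b + c)"]
    unfolding J_def bracketW_nested
    by (simp_all only: ac_simps add_0)
  have "J x y z = 0"
  proof (induction x rule: W_induct)
    case (L a)
    show ?case
    proof (induction y rule: W_induct)
      case (L b)
      show ?case by (induction z rule: W_induct) (simp_all add: basis add scale)
    next
      case (M b)
      show ?case by (induction z rule: W_induct) (simp_all add: basis add scale)
    qed (simp_all add: add scale)
  next
    case (M a)
    show ?case
    proof (induction y rule: W_induct)
      case (L b)
      show ?case by (induction z rule: W_induct) (simp_all add: basis add scale)
    next
      case (M b)
      show ?case by (induction z rule: W_induct) (simp_all add: basis add scale)
    qed (simp_all add: add scale)
  qed (simp_all add: add scale)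
  then show ?thesis
    by (simp add: J_def)
qed

theorem hom_Lie_algebra_W:
  assumes "q \<noteq> 0"
  shows "hom_Lie_algebra scaleW (bracketW q) (alphaW q)"
  unfolding hom_Lie_algebra_def skew_bilinear_def
  using linear_bracketW_left linear_bracketW_right bracketW_skew linear_alphaW
    bracketW_hom_jacobi[OF assms] by blast

end

theory Submission
  imports Defs
begin

text \<open>
  Write \<open>\<lambda>\<^sub>n = q\<^sup>n + q\<^sup>-\<^sup>n\<close> for the eigenvalues of \<open>\<alpha>\<close>. As \<open>q\<close> is not a root of unity,
  \<open>\<lambda>\<^sub>j = \<lambda>\<^sub>n\<close> only for \<open>j = n\<close> and \<open>j = - n\<close>, so a map commuting with \<open>\<alpha>\<close> sends a basis vector
  of degree \<open>n\<close> to a combination of basis vectors of degree \<open>\<plusminus>n\<close>.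

  The operator \<open>[L\<^sub>0, _]\<close> acts on degree \<open>j\<close> as the scalar \<open>[j]\<^sub>q\<close>, and \<open>\<alpha>\<^sup>k\<close> multiplies \<open>L\<^sub>0\<close> by
  \<open>2\<^sup>k\<close>. Comparing coefficients in the derivation rule for \<open>[L\<^sub>0, L\<^sub>m]\<close> therefore gives factors
  \<open>1 + 2\<^sup>k\<close> in degree \<open>- m\<close> and \<open>1 - 2\<^sup>k\<close> in degree \<open>m\<close>. The first removes the component of
  \<open>D L\<^sub>m\<close> of degree \<open>- m\<close>. For the second, the coefficient \<open>f(m)\<close> of \<open>D L\<^sub>m\<close> at \<open>L\<^sub>m\<close> (or at
  \<open>M\<^sub>m\<close>) satisfies
  \<open>f(m + n) = \<lambda>\<^sub>n\<^sup>k f(m) + \<lambda>\<^sub>m\<^sup>k f(n)\<close> for \<open>m \<noteq> n\<close>, and the lemma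
  \<open>twisted_additive_eq_zero\<close> shows that this forces \<open>f = 0\<close> unless \<open>\<lambda>\<^sub>0\<^sup>k = 2\<^sup>k\<close>
  is \<open>1\<close> or \<open>1/2\<close>, which \<open>k > 0\<close> excludes. Hence \<open>D\<close> kills every \<open>L\<^sub>m\<close>.

  Once \<open>D L\<^sub>0 = 0\<close>, the rule for \<open>[L\<^sub>0, M\<^sub>m]\<close> kills \<open>D M\<^sub>m\<close> for \<open>m \<noteq> 0\<close> in the same way, and
  \<open>M\<^sub>0\<close> is a nonzero multiple of \<open>[L\<^sub>1, M\<^sub>-\<^sub>1]\<close>.
\<close>

section \<open>Eigenvalues of the twist\<close>

definition alpha_eigenvalue :: "complex \<Rightarrow> int \<Rightarrow> complex" where
  "alpha_eigenvalue q n = q powi n + q powi (- n)"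

lemma alpha_eigenvalue_minus: "alpha_eigenvalue q (- n) = alpha_eigenvalue q n"
  by (simp add: alpha_eigenvalue_def add.commute)

lemma alpha_eigenvalue_0: "alpha_eigenvalue q 0 = 2"
  by (simp add: alpha_eigenvalue_def)

lemma eq_minus_multiple_imp_zero:
  fixes a t x :: complex
  assumes "a * x = t * (- a) * x" "a \<noteq> 0" "t \<noteq> - 1"
  shows "x = 0"
proof -
  have "(t - (- 1)) * (a * x) = 0"
    using assms(1) by algebra
  then show ?thesis
    using assms(2,3) by (simp only: mult_eq_0_iff right_minus_eq) blast
qed

lemma powi_eq_1_imp_zero:
  fixes q :: complex
  assumes root: "\<forall>n::nat. n > 0 \<longrightarrow> q ^ n \<noteq> 1" and "q powi n = 1"
  shows "n = 0"
proof (rule ccontr)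
  assume "n \<noteq> 0"
  moreover have "q ^ nat \<bar>n\<bar> = 1"
    using assms(2) by (auto simp: power_int_def inverse_eq_1_iff power_inverse split: if_splits)
  ultimately show False
    using root by (metis zero_less_abs_iff zero_less_nat_eq)
qed

lemma qnum_nonzero:
  assumes "q \<noteq> 0" "\<forall>n::nat. n > 0 \<longrightarrow> q ^ n \<noteq> 1" "n \<noteq> 0"
  shows "qnum q n \<noteq> 0"
proof -
  have *: "q powi m - q powi (- m) \<noteq> 0" if "m \<noteq> 0" for m
  proof
    assume "q powi m - q powi (- m) = 0"
    then have "q powi m * q powi m = q powi (- m) * q powi m"
      by simp
    then have "q powi (m + m) = 1"
      using assms(1) by (subst power_int_add) (simp_all add: power_int_minus)
    then show False
      using powi_eq_1_imp_zero[OF assms(2), of "m + m"] that by linarith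
  qed
  show ?thesis
    using *[OF assms(3)] *[of 1] by (simp add: qnum_def power_int_minus)
qed

lemma alpha_eigenvalue_eq_imp:
  assumes "q \<noteq> 0" "\<forall>n::nat. n > 0 \<longrightarrow> q ^ n \<noteq> 1"
    and "alpha_eigenvalue q j = alpha_eigenvalue q n"
  shows "j = n \<or> j = - n"
proof -
  have "(q powi j - q powi n) * (1 - q powi (- j - n))
      = alpha_eigenvalue q j - alpha_eigenvalue q n"
    using assms(1) by (simp add: alpha_eigenvalue_def algebra_simps flip: power_int_add)
  then consider "q powi j = q powi n" | "q powi (- j - n) = 1"
    using assms(3) by auto
  then show ?thesis
  proof cases
    case 1
    then have "q powi (j - n) = 1"
      using assms(1) by (simp add: power_int_diff)
    then show ?thesis
      using powi_eq_1_imp_zero[OF assms(2)] by force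
  next
    case 2
    then show ?thesis
      using powi_eq_1_imp_zero[OF assms(2)] by force
  qed
qed

section \<open>A twisted additive functional equation\<close>

text \<open>
  The instances \<open>n = 0\<close> express all values through \<open>a = f 0\<close>, namely \<open>(1 - \<mu> 0) f(m) = \<mu> m a\<close>.
  If \<open>a \<noteq> 0\<close>, then the pairs \<open>(m, - m)\<close> show that \<open>(\<mu> m)\<^sup>2\<close> has one value \<open>C = (1 - \<mu> 0) / 2\<close> for
  all \<open>m \<noteq> 0\<close>, while the pair \<open>(1, 2)\<close> gives \<open>\<mu> 3 = 2 \<mu> 1 \<mu> 2\<close>. Squaring yields \<open>C = 4 C\<^sup>2\<close>, hence
  \<open>\<mu> 0 \<in> {1, 1/2}\<close>.
\<close>

lemma twisted_additive_eq_zero: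
  fixes f \<mu> :: "int \<Rightarrow> complex"
  assumes add: "\<And>m n. m \<noteq> n \<Longrightarrow> f (m + n) = \<mu> n * f m + \<mu> m * f n"
    and even: "\<And>n. \<mu> (- n) = \<mu> n"
    and "\<mu> 0 \<noteq> 1" "2 * \<mu> 0 \<noteq> 1"
  shows "f m = 0"
proof -
  define s where "s = 1 - \<mu> 0"
  have s: "s \<noteq> 0" "2 * s \<noteq> 1"
    using assms(3,4) by (auto simp: s_def algebra_simps)
  have f: "s * f n = \<mu> n * f 0" if "n \<noteq> 0" for n
    using add[of n 0] that by (simp add: s_def algebra_simps)
  have "f 0 = 0"
  proof (rule ccontr)
    assume a: "f 0 \<noteq> 0"
    have sq: "2 * (\<mu> n)^2 = s" if "n \<noteq> 0" for n
    proof -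
      have "f 0 = \<mu> n * f n + \<mu> n * f (- n)"
        using add[of n "- n"] that by (simp add: even)
      then have "s * f 0 = \<mu> n * (s * f n) + \<mu> n * (s * f (- n))"
        by (metis distrib_left mult.left_commute)
      also have "\<dots> = 2 * (\<mu> n)^2 * f 0"
        using that by (simp add: f even power2_eq_square)
      finally show ?thesis
        using a by simp
    qed
    have "f 3 = \<mu> 2 * f 1 + \<mu> 1 * f 2"
      using add[of 1 2] by simp
    then have "s * f 3 = \<mu> 2 * (s * f 1) + \<mu> 1 * (s * f 2)"
      by (metis distrib_left mult.left_commute)
    then have "\<mu> 3 * f 0 = (2 * \<mu> 1 * \<mu> 2) * f 0"
      using f[of 1] f[of 2] f[of 3] by (simp add: mult.assoc)
    then have "\<mu> 3 = 2 * \<mu> 1 * \<mu> 2"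
      using a by simp
    then have "2 * (\<mu> 3)^2 = 2 * (2 * (\<mu> 1)^2) * (2 * (\<mu> 2)^2)"
      by (simp add: power_mult_distrib)
    then have "s = 2 * s * s"
      using sq[of 1] sq[of 2] sq[of 3] by simp
    then show False
      using s by simp
  qed
  then show ?thesis
    using f[of m] s by (cases "m = 0") auto
qed

section \<open>The twist and the bracket in coordinates\<close>

lemma lookup_L:
  "Poly_Mapping.lookup (L n) (L_index j) = (if n = j then 1 else 0)"
  "Poly_Mapping.lookup (L n) (M_index j) = 0"
  by (auto simp: L_def lookup_single when_def)

lemma lookup_M:
  "Poly_Mapping.lookup (M n) (M_index j) = (if n = j then 1 else 0)"
  "Poly_Mapping.lookup (M n) (L_index j) = 0"
  by (auto simp: M_def lookup_single when_def)

lemma W_eq_zeroI: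
  assumes "\<And>c j. c = L_index \<or> c = M_index \<Longrightarrow> Poly_Mapping.lookup x (c j) = 0"
  shows "x = (0 :: W)"
proof (rule poly_mapping_eqI)
  fix i show "Poly_Mapping.lookup x i = Poly_Mapping.lookup 0 i"
    using assms by (cases i) auto
qed

lemma lookup_alphaW:
  assumes "c = L_index \<or> c = M_index"
  shows "Poly_Mapping.lookup (alphaW q x) (c j)
       = alpha_eigenvalue q j * Poly_Mapping.lookup x (c j)"
  using assms
  by (induction x rule: W_induct)
     (auto simp: alphaW_simps alphaW_linear lookup_add lookup_L lookup_M alpha_eigenvalue_def
       algebra_simps)

text \<open>
  The bracket with \<open>L\<^sub>n\<close> acts by the same formula on the span of the \<open>L\<^sub>j\<close> and on the span of the
  \<open>M\<^sub>j\<close>; letting \<open>c\<close> range over the two constructors treats both components of \<open>D x\<close> at once.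
\<close>

lemma lookup_bracketW_L:
  assumes "c = L_index \<or> c = M_index"
  shows "Poly_Mapping.lookup (bracketW q (L n) x) (c j)
       = qnum q (j - 2 * n) * Poly_Mapping.lookup x (c (j - n))"
  using assms
  by (induction x rule: W_induct)
     (auto simp: bracketW_simps bracketW_bilinear lookup_add lookup_L lookup_M algebra_simps)

lemma alphaW_power_L:
  "(alphaW q ^^ k) (L n) = scaleW (alpha_eigenvalue q n ^ k) (L n)"
  by (induction k)
     (simp_all add: alphaW_linear alphaW_simps alpha_eigenvalue_def mult.commute)

section \<open>Derivations vanish on the basis\<close>

locale W_alpha_derivation =
  fixes q :: complex and k :: nat and D :: "W \<Rightarrow> W"
  assumes q: "q \<noteq> 0" and root: "\<forall>n::nat. n > 0 \<longrightarrow> q ^ n \<noteq> 1" and k: "k > 0"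
    and der: "alpha_derivation scaleW (bracketW q) (alphaW q) k D"
begin

abbreviation \<mu> :: "int \<Rightarrow> complex" where
  "\<mu> n \<equiv> alpha_eigenvalue q n ^ k"

lemma D_add: "D (x + y) = D x + D y"
  and D_scale: "D (scaleW a x) = scaleW a (D x)"
  and D_alphaW: "D (alphaW q x) = alphaW q (D x)"
  and D_bracketW:
    "D (bracketW q x y)
       = bracketW q ((alphaW q ^^ k) x) (D y) - bracketW q ((alphaW q ^^ k) y) (D x)"
  using der unfolding alpha_derivation_def linearW_iff by (auto dest: fun_cong)

lemma mu_0: "\<mu> 0 = 2 ^ k"
  by (simp add: alpha_eigenvalue_0)

lemma two_power_gt_1: "(2::real) ^ k > 1"
  using k by (simp add: one_less_power)

lemma mu_0_ne: "\<mu> 0 \<noteq> 1" "\<mu> 0 \<noteq> - 1" "2 * \<mu> 0 \<noteq> 1"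
proof -
  have "\<mu> 0 = of_real (2 ^ k)"
    by (simp add: mu_0)
  then have "Re (\<mu> 0) > 1"
    using two_power_gt_1 by (metis Re_complex_of_real)
  then show "\<mu> 0 \<noteq> 1" "\<mu> 0 \<noteq> - 1" "2 * \<mu> 0 \<noteq> 1"
    by (auto simp: complex_eq_iff)
qed

text \<open>
  \<open>D\<close> maps an \<open>\<alpha>\<close>-eigenvector to an eigenvector with the same eigenvalue, and the only other
  degree sharing the eigenvalue of degree \<open>n\<close> is \<open>- n\<close>.
\<close>

lemma lookup_D_eigenvector_eq_zero:
  assumes c: "c = L_index \<or> c = M_index"
    and x: "alphaW q x = scaleW (alpha_eigenvalue q n) x"
    and j: "j \<noteq> n" "j \<noteq> - n"
  shows "Poly_Mapping.lookup (D x) (c j) = 0"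
proof -
  have "alpha_eigenvalue q j * Poly_Mapping.lookup (D x) (c j)
      = alpha_eigenvalue q n * Poly_Mapping.lookup (D x) (c j)"
    using lookup_alphaW[OF c, of q "D x" j] by (auto simp: x D_scale simp flip: D_alphaW)
  then show ?thesis
    using alpha_eigenvalue_eq_imp[OF q root] j by auto
qed

lemma lookup_D_L_eq_zero:
  assumes "c = L_index \<or> c = M_index" "j \<noteq> n" "j \<noteq> - n"
  shows "Poly_Mapping.lookup (D (L n)) (c j) = 0"
  using lookup_D_eigenvector_eq_zero[OF assms(1) _ assms(2,3)]
  by (simp add: alphaW_simps alpha_eigenvalue_def)

lemma lookup_D_M_eq_zero:
  assumes "c = L_index \<or> c = M_index" "j \<noteq> n" "j \<noteq> - n"
  shows "Poly_Mapping.lookup (D (M n)) (c j) = 0"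
  using lookup_D_eigenvector_eq_zero[OF assms(1) _ assms(2,3)]
  by (simp add: alphaW_simps alpha_eigenvalue_def)

lemma lookup_D_bracket_LL:
  assumes "c = L_index \<or> c = M_index"
  shows "qnum q (m - n) * Poly_Mapping.lookup (D (L (m + n))) (c j)
    = \<mu> n * qnum q (j - 2 * n) * Poly_Mapping.lookup (D (L m)) (c (j - n))
    - \<mu> m * qnum q (j - 2 * m) * Poly_Mapping.lookup (D (L n)) (c (j - m))"
  using arg_cong[OF D_bracketW[of "L n" "L m"], of "\<lambda>x. Poly_Mapping.lookup x (c j)"]
  by (simp add: bracketW_simps D_scale alphaW_power_L bracketW_bilinear lookup_minus
      lookup_bracketW_L[OF assms])

lemma diagonal_coefficient_D_L:
  assumes c: "c = L_index \<or> c = M_index"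
  shows "Poly_Mapping.lookup (D (L m)) (c m) = 0"
proof (rule twisted_additive_eq_zero[where f = "\<lambda>m. Poly_Mapping.lookup (D (L m)) (c m)"
      and \<mu> = \<mu>])
  fix m n :: int assume "m \<noteq> n"
  then have "qnum q (m - n) \<noteq> 0"
    using qnum_nonzero[OF q root] by simp
  moreover have "qnum q (m - n) * Poly_Mapping.lookup (D (L (m + n))) (c (m + n))
    = qnum q (m - n) * (\<mu> n * Poly_Mapping.lookup (D (L m)) (c m)
        + \<mu> m * Poly_Mapping.lookup (D (L n)) (c n))"
    using lookup_D_bracket_LL[OF c, of m n "m + n"] qnum_minus[of q "m - n"]
    by (simp add: algebra_simps)
  ultimately show "Poly_Mapping.lookup (D (L (m + n))) (c (m + n))
    = \<mu> n * Poly_Mapping.lookup (D (L m)) (c m) + \<mu> m * Poly_Mapping.lookup (D (L n)) (c n)"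
    by (metis mult_left_cancel)
qed (use mu_0_ne in \<open>auto simp: alpha_eigenvalue_minus\<close>)

text \<open>
  Bracketing with \<open>L\<^sub>0\<close> gives \<open>[m] x = 2\<^sup>k [- m] x\<close> for the coefficient \<open>x\<close>. The other term of
  the derivation rule involves \<open>D L\<^sub>0\<close> in degree \<open>- 2 m\<close>, where it vanishes because \<open>D L\<^sub>0\<close> is
  concentrated in degree \<open>0\<close>.
\<close>

lemma antidiagonal_coefficient_D_L:
  assumes c: "c = L_index \<or> c = M_index" and "m \<noteq> 0"
  shows "Poly_Mapping.lookup (D (L m)) (c (- m)) = 0"
proof -
  have "qnum q m * Poly_Mapping.lookup (D (L m)) (c (- m))
      = \<mu> 0 * qnum q (- m) * Poly_Mapping.lookup (D (L m)) (c (- m))"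
    using lookup_D_bracket_LL[OF c, of m 0 "- m"]
      lookup_D_L_eq_zero[OF c, of "- m - m" 0] assms(2) by simp
  then show ?thesis
    using qnum_nonzero[OF q root assms(2)] mu_0_ne(2) unfolding qnum_minus
    by (rule eq_minus_multiple_imp_zero)
qed

lemma D_L: "D (L m) = 0"
proof (rule W_eq_zeroI)
  fix c :: "int \<Rightarrow> W_index" and j assume c: "c = L_index \<or> c = M_index"
  show "Poly_Mapping.lookup (D (L m)) (c j) = 0"
    using lookup_D_L_eq_zero[OF c] diagonal_coefficient_D_L[OF c]
      antidiagonal_coefficient_D_L[OF c] by (metis minus_zero)
qed

lemma D_bracket_LM:
  "scaleW (qnum q (m - n)) (D (M (m + n))) = scaleW (\<mu> n) (bracketW q (L n) (D (M m)))"
  using D_bracketW[of "L n" "M m"]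
  by (simp add: bracketW_simps D_scale alphaW_power_L bracketW_bilinear D_L bracketW_zero)

text \<open>
  By \<open>D_bracket_LM\<close> with \<open>n = 0\<close>, a coefficient of \<open>D M\<^sub>m\<close> in degree \<open>j\<close> can be nonzero only if
  \<open>[m] = 2\<^sup>k [j]\<close>, which fails for both \<open>j = m\<close> and \<open>j = - m\<close>.
\<close>

lemma D_M_nonzero_degree:
  assumes "m \<noteq> 0"
  shows "D (M m) = 0"
proof (rule W_eq_zeroI)
  fix c :: "int \<Rightarrow> W_index" and j assume c: "c = L_index \<or> c = M_index"
  let ?x = "Poly_Mapping.lookup (D (M m)) (c j)"
  have eq: "qnum q m * ?x = \<mu> 0 * qnum q j * ?x"
    using arg_cong[OF D_bracket_LM[of m 0], of "\<lambda>x. Poly_Mapping.lookup x (c j)"]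
    by (simp add: lookup_bracketW_L[OF c])
  consider "j = m" | "j = - m" | "j \<noteq> m" "j \<noteq> - m"
    by blast
  then show "?x = 0"
  proof cases
    case 1
    then have "(1 - \<mu> 0) * (qnum q m * ?x) = 0"
      using eq by (simp add: algebra_simps)
    then show ?thesis
      using qnum_nonzero[OF q root assms] mu_0_ne(1) by auto
  next
    case 2
    from eq show ?thesis
      using qnum_nonzero[OF q root assms] mu_0_ne(2) unfolding 2 qnum_minus
      by (rule eq_minus_multiple_imp_zero)
  next
    case 3
    then show ?thesis
      by (rule lookup_D_M_eq_zero[OF c])
  qed
qed

lemma D_M: "D (M m) = 0"
proof (cases "m = 0")
  case True
  \<comment> \<open>\<open>[L\<^sub>1, M\<^sub>-\<^sub>1]\<close> is \<open>[- 2]\<^sub>q M\<^sub>0\<close>, a nonzero multiple of \<open>M\<^sub>0\<close>.\<close>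
  have "scaleW (qnum q (- 2)) (D (M 0)) = 0"
    using D_bracket_LM[of "- 1" 1] by (simp add: D_M_nonzero_degree bracketW_zero)
  then show ?thesis
    using True qnum_nonzero[OF q root, of "- 2"] by simp
qed (rule D_M_nonzero_degree)

lemma D_eq_zero: "D x = 0"
  by (induction x rule: W_induct) (simp_all add: D_L D_M D_add D_scale)

end

theorem proposition3p13:
  fixes q :: complex and k :: nat and D :: "W \<Rightarrow> W"
  assumes "q \<noteq> 0"
    and "\<forall>n::nat. n > 0 \<longrightarrow> q ^ n \<noteq> 1"
    and "k > 0"
    and "alpha_derivation scaleW (bracketW q) (alphaW q) k D"
  shows "\<forall>x. D x = 0"
proof -
  interpret W_alpha_derivation q k D
    using assms by unfold_locales
  show ?thesis
    using D_eq_zero by blast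
qed

end
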